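(* In the setting of the context, suppose that for every $n\in\mathcal N$ the function $\psi_n$ is a penalty function that is 1-Lipschitz continuous on the compact set $\mathcal X_{a(n)}-\mathcal X_{a(n)}$. Then for every $n\in\mathcal N$, $Q_n^{\mathrm R}(x)\le Q_n(x)$ for all $x\in\mathcal X_{a(n)}$, and $Q_n^{\mathrm R}$ is $\sigma_n$-Lipschitz continuous on $\mathcal X_{a(n)}$. Moreover, if the original problem (all $\mathcal F_n$ and all $f_n$) and the penalty functions $\psi_n$ are convex, then $Q_n^{\mathrm R}$ is also convex.
   Context: $\mathcal N$ is the node set of a finite rooted scenario tree with root $r$; $a(n)$ is the parent and $\mathcal C(n)$ the set of children of $n$. $p_n>0$ is the probability of node $n$, $p_r=1$, $p_{nm}=p_m/p_n$ for $m\in\mathcal C(n)$. For each $n$, $\mathcal F_n$ is a compact set of pairs $(x_n,y_n)$ in a Euclidean space and $\mathcal X_n$ is its projection onto the $x_n$-coordinates; $\mathcal X_{a(r)}=\{0\}$. The cost $f_n(z,y,x)\in[0,+\infty]$, defined for $z\in\mathcal X_{a(n)}$, $(x,y)\in\mathcal F_n$, is lower semicontinuous. There exist $(x_n,y_n)\in\mathcal F_n$, $n\in\mathcal N$ (with $x_{a(r)}=0$), such that $\sum_n p_nf_n(x_{a(n)},y_n,x_n)<+\infty$. Fix a norm $\|\cdot\|$. Value functions, recursively from the leaves (sums over $\mathcal C(n)=\varnothing$ are $0$): $$Q_n(x_{a(n)})=\min_{(x,y)\in\mathcal F_n}\Big\{f_n(x_{a(n)},y,x)+\sum_{m\in\mathcal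 C(n)}p_{nm}Q_m(x)\Big\},$$ $$Q_n^{\mathrm R}(x_{a(n)})=\min_{(x,y)\in\mathcal F_n,\ z\in\mathcal X_{a(n)}}\Big\{f_n(z,y,x)+\sigma_n\psi_n(x_{a(n)}-z)+\sum_{m\in\mathcal C(n)}p_{nm}Q_m^{\mathrm R}(x)\Big\},$$ with given $\sigma_n>0$. A penalty function is $\psi:\mathbb R^d\to\mathbb R_+$ with $\psi(x)=0$ iff $x=0$ and with the diameter of $\{\psi\le a\}$ tending to $0$ as $a\to0$. *)

theory Defs
  imports "HOL-Analysis.Analysis"
begin

definition is_norm :: "('a::real_vector \<Rightarrow> real) \<Rightarrow> bool" where
  "is_norm N \<longleftrightarrow>
     (\<forall>x. N x \<ge> 0) \<and> (\<forall>x. N x = 0 \<longleftrightarrow> x = 0) \<and>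
     (\<forall>c x. N (c *\<^sub>R x) = \<bar>c\<bar> * N x) \<and> (\<forall>x y. N (x + y) \<le> N x + N y)"

text \<open>
  The diameter takes values in $[0,\infty]$, since the library's real-valued \<^const>\<open>diameter\<close>
  is meaningless on unbounded sets and is tied to the norm of the type class.
\<close>

definition ediameter :: "('a::real_vector \<Rightarrow> real) \<Rightarrow> 'a set \<Rightarrow> ennreal" where
  "ediameter N S = (SUP u\<in>S. SUP v\<in>S. ennreal (N (u - v)))"

definition penalty_function :: "('a::real_vector \<Rightarrow> real) \<Rightarrow> 'a set \<Rightarrow> ('a \<Rightarrow> real) \<Rightarrow> bool" where
  "penalty_function N V \<psi> \<longleftrightarrow>
     (\<forall>x\<in>V. \<psi> x \<ge> 0) \<and> (\<forall>x\<in>V. \<psi> x = 0 \<longleftrightarrow> x = 0) \<and>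
     ((\<lambda>a. ediameter N {x \<in> V. \<psi> x \<le> a}) \<longlongrightarrow> 0) (at_right 0)"

text \<open>The library's \<^const>\<open>lipschitz_on\<close> only covers the norm of the type class.\<close>

definition lipschitz_wrt ::
    "('a::real_vector \<Rightarrow> real) \<Rightarrow> real \<Rightarrow> 'a set \<Rightarrow> ('a \<Rightarrow> real) \<Rightarrow> bool" where
  "lipschitz_wrt N L S g \<longleftrightarrow> L \<ge> 0 \<and> (\<forall>u\<in>S. \<forall>v\<in>S. \<bar>g u - g v\<bar> \<le> L * N (u - v))"

text \<open>Lipschitz continuity of a $[0,\infty]$-valued function includes finiteness.\<close>

definition ext_lipschitz_wrt ::
    "('a::real_vector \<Rightarrow> real) \<Rightarrow> real \<Rightarrow> 'a set \<Rightarrow> ('a \<Rightarrow> ennreal) \<Rightarrow> bool" where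
  "ext_lipschitz_wrt N L S g \<longleftrightarrow>
     (\<forall>u\<in>S. g u < \<infinity>) \<and> lipschitz_wrt N L S (\<lambda>u. enn2real (g u))"

definition lsc_on :: "'a::topological_space set \<Rightarrow> ('a \<Rightarrow> ennreal) \<Rightarrow> bool" where
  "lsc_on S g \<longleftrightarrow> (\<forall>u\<in>S. g u \<le> Liminf (at u within S) g)"

definition ext_convex_on :: "'a::real_vector set \<Rightarrow> ('a \<Rightarrow> ennreal) \<Rightarrow> bool" where
  "ext_convex_on S g \<longleftrightarrow> convex S \<and>
     (\<forall>x\<in>S. \<forall>y\<in>S. \<forall>u\<ge>0. \<forall>v\<ge>0. u + v = 1 \<longrightarrow>
        g (u *\<^sub>R x + v *\<^sub>R y) \<le> ennreal u * g x + ennreal v * g y)"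

definition children :: "'n set \<Rightarrow> ('n \<Rightarrow> 'n) \<Rightarrow> 'n \<Rightarrow> 'n set" where
  "children Nodes par n = {m \<in> Nodes. par m = n}"

text \<open>The parent \<open>par r\<close> of the root is an artificial index outside the node set.\<close>

locale scenario_tree =
  fixes Nodes :: "'n set" and r :: 'n and par :: "'n \<Rightarrow> 'n"
  assumes finite_Nodes: "finite Nodes"
    and root_in: "r \<in> Nodes"
    and par_root: "par r \<notin> Nodes"
    and par_in: "\<And>n. n \<in> Nodes \<Longrightarrow> n \<noteq> r \<Longrightarrow> par n \<in> Nodes"
    and reaches_root: "\<And>n. n \<in> Nodes \<Longrightarrow> \<exists>k. (par ^^ k) n = r"

definition child_rel :: "'n set \<Rightarrow> ('n \<Rightarrow> 'n) \<Rightarrow> ('n \<times> 'n) set" where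
  "child_rel Nodes par = {(m, n). n \<in> Nodes \<and> m \<in> children Nodes par n}"

lemma (in scenario_tree) wf_child_rel: "wf (child_rel Nodes par)"
proof -
  define depth where "depth n = (LEAST k. (par ^^ k) n = r)" for n
  have "depth n < depth m" if mn: "(m, n) \<in> child_rel Nodes par" for m n
  proof -
    have m: "m \<in> Nodes" "par m = n" "n \<in> Nodes"
      using mn by (auto simp: child_rel_def children_def)
    have "m \<noteq> r" using m par_root by auto
    have "(par ^^ depth m) m = r"
      unfolding depth_def using reaches_root[OF m(1)] by (rule LeastI_ex)
    then obtain j where j: "depth m = Suc j"
      using \<open>m \<noteq> r\<close> by (cases "depth m") auto
    then have "(par ^^ j) n = r"
      using \<open>(par ^^ depth m) m = r\<close> m(2) by (simp add: funpow_Suc_right del: funpow.simps)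
    then have "depth n \<le> j"
      unfolding depth_def by (rule Least_le)
    then show ?thesis using j by simp
  qed
  then have "(child_rel Nodes par)\<inverse> \<subseteq> inv_image less_than depth" by auto
  then have "acyclic ((child_rel Nodes par)\<inverse>)"
    using wf_subset[OF wf_inv_image[OF wf_less_than]] wf_acyclic by blast
  moreover have "finite (child_rel Nodes par)"
    by (rule finite_subset[of _ "Nodes \<times> Nodes"])
      (auto simp: child_rel_def children_def finite_Nodes)
  ultimately show ?thesis
    by (simp add: finite_acyclic_wf acyclic_converse)
qed

text \<open>State set of a node: the projection of \<open>F n\<close>, and $\{0\}$ at the artificial parent of the root.\<close>

definition state_set ::
    "('n \<Rightarrow> ('a::zero \<times> 'b) set) \<Rightarrow> 'n \<Rightarrow> ('n \<Rightarrow> 'n) \<Rightarrow> 'n \<Rightarrow> 'a set" where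
  "state_set F r par n = (if n = par r then {0} else fst ` F n)"

definition cost_domain ::
    "('n \<Rightarrow> ('a::zero \<times> 'b) set) \<Rightarrow> 'n \<Rightarrow> ('n \<Rightarrow> 'n) \<Rightarrow> 'n \<Rightarrow> ('a \<times> 'b \<times> 'a) set" where
  "cost_domain F r par n = {(z, y, x). z \<in> state_set F r par (par n) \<and> (x, y) \<in> F n}"

text \<open>
  \<open>E n\<close> is the Euclidean space in which the states of node \<open>n\<close> live: a linear subspace of a common
  ambient type, so that the state dimension may depend on the node. The local variables \<open>y\<close> of all
  nodes live in one type, into which spaces of smaller dimension embed.
  No relation between the weight of a node and those of its children is required.
\<close>

locale multistage_program = scenario_tree Nodes r par
  for Nodes :: "'n set" and r :: 'n and par :: "'n \<Rightarrow> 'n" +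
  fixes p :: "'n \<Rightarrow> real"
    and E :: "'n \<Rightarrow> 'a::euclidean_space set"
    and F :: "'n \<Rightarrow> ('a \<times> 'b::euclidean_space) set"
    and f :: "'n \<Rightarrow> 'a \<Rightarrow> 'b \<Rightarrow> 'a \<Rightarrow> ennreal"
  assumes p_pos: "\<And>n. n \<in> Nodes \<Longrightarrow> p n > 0"
    and p_root: "p r = 1"
    and subspace_E: "\<And>n. n \<in> insert (par r) Nodes \<Longrightarrow> subspace (E n)"
    and states_in_E: "\<And>n. n \<in> Nodes \<Longrightarrow> fst ` F n \<subseteq> E n"
    and compact_F: "\<And>n. n \<in> Nodes \<Longrightarrow> compact (F n)"
    and lsc_f: "\<And>n. n \<in> Nodes \<Longrightarrow>
        lsc_on (cost_domain F r par n) (\<lambda>(z, y, x). f n z y x)"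
    and feasible: "\<exists>x y. x (par r) = 0 \<and> (\<forall>n\<in>Nodes. (x n, y n) \<in> F n) \<and>
        (\<Sum>n\<in>Nodes. ennreal (p n) * f n (x (par n)) (y n) (x n)) < \<infinity>"

text \<open>
  The minimum is rendered by \<open>LEAST\<close>, not by an infimum: that it is attained is not built into
  the definition. The recursion runs from the leaves to the root along the well-founded child
  relation; the recursion equations are derived below.
\<close>

definition value_fun ::
    "'n set \<Rightarrow> ('n \<Rightarrow> 'n) \<Rightarrow> ('n \<Rightarrow> real) \<Rightarrow> ('n \<Rightarrow> ('a \<times> 'b) set)
     \<Rightarrow> ('n \<Rightarrow> 'a \<Rightarrow> 'b \<Rightarrow> 'a \<Rightarrow> ennreal) \<Rightarrow> 'n \<Rightarrow> 'a \<Rightarrow> ennreal" where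
  "value_fun Nodes par p F f = wfrec (child_rel Nodes par) (\<lambda>Q n xa.
     LEAST v. \<exists>x y. (x, y) \<in> F n \<and>
       v = f n xa y x + (\<Sum>m\<in>children Nodes par n. ennreal (p m / p n) * Q m x))"

definition reg_value_fun ::
    "'n set \<Rightarrow> 'n \<Rightarrow> ('n \<Rightarrow> 'n) \<Rightarrow> ('n \<Rightarrow> real) \<Rightarrow> ('n \<Rightarrow> ('a::real_vector \<times> 'b) set)
     \<Rightarrow> ('n \<Rightarrow> 'a \<Rightarrow> 'b \<Rightarrow> 'a \<Rightarrow> ennreal) \<Rightarrow> ('n \<Rightarrow> real) \<Rightarrow> ('n \<Rightarrow> 'a \<Rightarrow> real)
     \<Rightarrow> 'n \<Rightarrow> 'a \<Rightarrow> ennreal" where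
  "reg_value_fun Nodes r par p F f \<sigma> \<psi> = wfrec (child_rel Nodes par) (\<lambda>Q n xa.
     LEAST v. \<exists>x y z. (x, y) \<in> F n \<and> z \<in> state_set F r par (par n) \<and>
       v = f n z y x + ennreal (\<sigma> n * \<psi> n (xa - z))
           + (\<Sum>m\<in>children Nodes par n. ennreal (p m / p n) * Q m x))"

context scenario_tree
begin

lemma cut_child:
  "n \<in> Nodes \<Longrightarrow> m \<in> children Nodes par n \<Longrightarrow> cut Q (child_rel Nodes par) n m = Q m"
  by (simp add: cut_def child_rel_def)

lemma value_fun_eq:
  assumes "n \<in> Nodes"
  shows "value_fun Nodes par p F f n xa =
    (LEAST v. \<exists>x y. (x, y) \<in> F n \<and>
       v = f n xa y x
           + (\<Sum>m\<in>children Nodes par n. ennreal (p m / p n) * value_fun Nodes par p F f m x))"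
  unfolding value_fun_def
  by (subst wfrec[OF wf_child_rel]) (simp add: cut_child[OF assms] cong: sum.cong)

lemma reg_value_fun_eq:
  assumes "n \<in> Nodes"
  shows "reg_value_fun Nodes r par p F f \<sigma> \<psi> n xa =
    (LEAST v. \<exists>x y z. (x, y) \<in> F n \<and> z \<in> state_set F r par (par n) \<and>
       v = f n z y x + ennreal (\<sigma> n * \<psi> n (xa - z))
           + (\<Sum>m\<in>children Nodes par n.
                ennreal (p m / p n) * reg_value_fun Nodes r par p F f \<sigma> \<psi> m x))"
  unfolding reg_value_fun_def
  by (subst wfrec[OF wf_child_rel]) (simp add: cut_child[OF assms] cong: sum.cong)

end

end

theory Submission
  imports Defs
begin

text \<open>
  An extended-valued function is lower semicontinuous iff its sublevel sets are relatively closed.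
  Over a compact domain this makes minima attained, and minimising out a variable preserves lower
  semicontinuity because sublevel sets of the minimum are projections of compact sets. Induction
  from the leaves then shows that the minima defining both value functions exist. In the regularised
  problem the argument of the value function enters only through the penalty, so comparing
  objective values at a common minimiser gives the Lipschitz bound; choosing the copy \<open>z\<close> equal
  to the argument gives the comparison with the original value function; and convexity is that of a
  partial minimum of a jointly convex objective.
\<close>

section \<open>Lower semicontinuity and attained minima\<close>

lemma lsc_on_iff_eventually:
  "lsc_on S g \<longleftrightarrow> (\<forall>u\<in>S. \<forall>c<g u. \<forall>\<^sub>F x in at u within S. c < g x)"
  unfolding lsc_on_def le_Liminf_iff ..

text \<open>The complement of a sublevel set in \<open>S\<close> is a strict superlevel set, and
  lower semicontinuity at each of its points provides the neighbourhood that makes it relatively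
  open. In this form compactness arguments apply directly.\<close>

lemma lsc_on_iff_closedin:
  "lsc_on S g \<longleftrightarrow> (\<forall>c. closedin (top_of_set S) {x\<in>S. g x \<le> c})"
proof -
  define nbhd where
    "nbhd u c \<longleftrightarrow> (\<exists>T. open T \<and> u \<in> T \<and> (\<forall>x\<in>S. x \<in> T \<longrightarrow> c < g x))" for u c
  have ev: "(\<forall>\<^sub>F x in at u within S. c < g x) \<longleftrightarrow> nbhd u c" if "c < g u" for u c
  proof -
    \<comment> \<open>The filter \<open>at u within S\<close> ignores \<open>u\<close> itself; since
      \<open>c < g u\<close> already holds, punctured and full neighbourhoods give the same
      condition.\<close>
    have "(x \<noteq> u \<longrightarrow> x \<in> S \<longrightarrow> c < g x) \<longleftrightarrow> (x \<in> S \<longrightarrow> c < g x)" for x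
      using that by (cases "x = u") simp_all
    then show ?thesis
      unfolding eventually_at_topological nbhd_def by (metis (no_types))
  qed
  have sub: "closedin (top_of_set S) {x\<in>S. g x \<le> c} \<longleftrightarrow> (\<forall>u\<in>S. c < g u \<longrightarrow> nbhd u c)" for c
  proof -
    have "closedin (top_of_set S) {x\<in>S. g x \<le> c} \<longleftrightarrow> openin (top_of_set S) (S - {x\<in>S. g x \<le> c})"
      by (simp add: closedin_def)
    also have "S - {x\<in>S. g x \<le> c} = {x\<in>S. c < g x}"
      by (auto simp: not_le)
    also have "openin (top_of_set S) {x\<in>S. c < g x} \<longleftrightarrow> (\<forall>u\<in>S. c < g u \<longrightarrow> nbhd u c)"
    proof
      assume "openin (top_of_set S) {x\<in>S. c < g x}"
      then obtain T where "open T" "{x\<in>S. c < g x} = S \<inter> T"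
        unfolding openin_open by blast
      then show "\<forall>u\<in>S. c < g u \<longrightarrow> nbhd u c"
        unfolding nbhd_def by blast
    next
      assume R: "\<forall>u\<in>S. c < g u \<longrightarrow> nbhd u c"
      show "openin (top_of_set S) {x\<in>S. c < g x}"
      proof (subst openin_subopen, intro ballI)
        fix u assume "u \<in> {x\<in>S. c < g x}"
        with R obtain T where T: "open T" "u \<in> T" "\<forall>x\<in>S. x \<in> T \<longrightarrow> c < g x" and u: "u \<in> S"
          unfolding nbhd_def by blast
        then show "\<exists>T. openin (top_of_set S) T \<and> u \<in> T \<and> T \<subseteq> {x\<in>S. c < g x}"
          by (intro exI[of _ "S \<inter> T"]) auto
      qed
    qed
    finally show ?thesis .
  qed
  show ?thesis
    unfolding lsc_on_iff_eventually sub by (auto simp: ev)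
qed

lemma lsc_on_compact_sublevel:
  assumes "compact K" "lsc_on K g"
  shows "compact {x\<in>K. g x \<le> c}"
  using assms closedin_compact unfolding lsc_on_iff_closedin by blast

lemma lsc_on_compose:
  assumes "lsc_on T g" "continuous_on S h" "h ` S \<subseteq> T"
  shows "lsc_on S (\<lambda>x. g (h x))"
  unfolding lsc_on_iff_closedin
proof
  fix c
  have "closedin (top_of_set S) (S \<inter> h -` {x\<in>T. g x \<le> c})"
    using assms by (intro continuous_closedin_preimage_gen[where T = T])
      (auto simp: lsc_on_iff_closedin)
  also have "S \<inter> h -` {x\<in>T. g x \<le> c} = {x\<in>S. g (h x) \<le> c}"
    using assms(3) by auto
  finally show "closedin (top_of_set S) {x\<in>S. g (h x) \<le> c}" .
qed

lemma continuous_imp_lsc_on: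
  assumes "continuous_on S g"
  shows "lsc_on S g"
  unfolding lsc_on_iff_eventually
  using assms by (auto simp: continuous_on order_tendsto_iff)

text \<open>Addition is continuous on the extended half-line, so a strict bound on a sum survives a
  small decrease of one positive summand. Doing this for each summand in turn gives the strict
  bounds from which lower semicontinuity of a sum follows.\<close>

lemma ennreal_less_add_split:
  fixes a b c :: ennreal
  assumes "c < a + b" "0 < a" "0 < b"
  obtains a' b' where "a' < a" "b' < b" "c < a' + b'"
proof -
  have left: "\<exists>x'<x. c < x' + y" if xy: "c < x + y" "0 < x" for x y :: ennreal
  proof -
    have "((\<lambda>t. t + y) \<longlongrightarrow> x + y) (at_left x)"
      by (intro tendsto_intros)
    then have "\<forall>\<^sub>F t in at_left x. c < t + y"
      using xy(1) by (rule order_tendstoD)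
    then obtain l where l: "l < x" "\<forall>t>l. t < x \<longrightarrow> c < t + y"
      \<comment> \<open>Positivity of \<open>x\<close> ensures that there are points to the left of
        it.\<close>
      unfolding eventually_at_left[OF xy(2)] by (elim exE conjE)
    from dense[OF l(1)] obtain t where "l < t" "t < x"
      by (elim exE conjE)
    with l(2) show ?thesis by (intro exI[of _ t]) simp
  qed
  obtain a' where a': "a' < a" "c < a' + b"
    using left[OF assms(1,2)] by blast
  then obtain b' where "b' < b" "c < b' + a'"
    using left[of b a'] assms(3) by (auto simp: add.commute)
  then show thesis
    using that a' by (auto simp: add.commute)
qed

lemma lsc_on_add:
  assumes g: "lsc_on S g" and h: "lsc_on S h"
  shows "lsc_on S (\<lambda>x. g x + h x)"
  unfolding lsc_on_iff_eventually
proof (intro ballI allI impI)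
  fix u c assume u: "u \<in> S" and c: "c < g u + h u"
  have ev: "\<forall>\<^sub>F x in at u within S. a < k x" if "lsc_on S k" "a < k u" for a k
    using that u by (auto simp: lsc_on_iff_eventually)
  \<comment> \<open>Nothing lies strictly below 0, so a vanishing summand cannot be lowered; its
    nonnegativity suffices instead.\<close>
  consider "g u = 0" | "h u = 0" | "0 < g u" "0 < h u"
    by (auto simp: zero_less_iff_neq_zero)
  then show "\<forall>\<^sub>F x in at u within S. c < g x + h x"
  proof cases
    case 1
    with c have "\<forall>\<^sub>F x in at u within S. c < h x"
      by (intro ev[OF h]) simp
    then show ?thesis
      by eventually_elim (simp add: add_increasing less_le_trans)
  next
    case 2
    with c have "\<forall>\<^sub>F x in at u within S. c < g x"
      by (intro ev[OF g]) simp
    then show ?thesis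
      by eventually_elim (simp add: add_increasing2 less_le_trans)
  next
    case 3
    then obtain a b where ab: "a < g u" "b < h u" "c < a + b"
      using ennreal_less_add_split[OF c] by blast
    from ev[OF g ab(1)] ev[OF h ab(2)] show ?thesis
      by eventually_elim (use ab(3) in \<open>meson add_mono less_imp_le less_le_trans\<close>)
  qed
qed

text \<open>For a finite positive factor, the sublevel set at level \<open>d\<close> is the one of
  \<open>g\<close> at level \<open>d / ennreal c\<close>.\<close>

lemma lsc_on_cmult:
  assumes "lsc_on S g" "0 < c"
  shows "lsc_on S (\<lambda>x. ennreal c * g x)"
proof -
  have "ennreal c * g x \<le> d \<longleftrightarrow> g x \<le> d / ennreal c" for x d
    using divide_less_ennreal[of "ennreal c" d "g x"] assms(2)
    by (simp add: mult.commute flip: not_less)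
  then show ?thesis
    using assms(1) by (simp add: lsc_on_iff_closedin)
qed

lemma lsc_on_sum:
  assumes "\<And>i. i \<in> I \<Longrightarrow> lsc_on S (g i)"
  shows "lsc_on S (\<lambda>x. \<Sum>i\<in>I. g i x)"
  using assms
  by (induction I rule: infinite_finite_induct)
    (auto intro: lsc_on_add continuous_imp_lsc_on)

text \<open>A minimiser is a point common to all sets \<open>?S i\<close>. These are closed and
  totally ordered by inclusion, so finitely many always meet, and the finite intersection property
  finishes.\<close>

lemma lsc_on_attains_min:
  fixes K :: "'a::t2_space set"
  assumes "compact K" "K \<noteq> {}" "lsc_on K g"
  obtains w where "w \<in> K" "\<And>w'. w' \<in> K \<Longrightarrow> g w \<le> g w'"
proof -
  let ?S = "\<lambda>i. {x\<in>K. g x \<le> g i}"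
  have cl: "closed (?S i)" for i
    using assms by (intro compact_imp_closed lsc_on_compact_sublevel)
  have "K \<inter> (\<Inter>i\<in>K. ?S i) \<noteq> {}"
  proof (rule compact_imp_fip_image[OF assms(1) cl])
    fix J assume J: "finite J" "J \<subseteq> K"
    show "K \<inter> (\<Inter>i\<in>J. ?S i) \<noteq> {}"
    proof (cases "J = {}")
      case False
      \<comment> \<open>The index with the smallest value lies in every set of the finite
        family.\<close>
      then have "Min (g ` J) \<in> g ` J"
        using J(1) by (intro Min_in) auto
      then obtain j where j: "j \<in> J" "g j = Min (g ` J)"
        by (elim imageE) simp
      have "g j \<le> g i" if "i \<in> J" for i
        unfolding j(2) using J(1) that by (intro Min_le) auto
      with j(1) J(2) have "j \<in> K \<inter> (\<Inter>i\<in>J. ?S i)"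
        by auto
      then show ?thesis by (metis (lifting) empty_iff)
    qed (use assms(2) in simp)
  qed
  then obtain w where "w \<in> K \<inter> (\<Inter>i\<in>K. ?S i)"
    by (meson ex_in_conv)
  then show thesis
    by (intro that[of w]) auto
qed

text \<open>Links the \<open>LEAST\<close> of the recursion equations to an actual minimiser, once
  one is known to exist.\<close>

lemma Least_attained:
  fixes g :: "'w \<Rightarrow> 'v::order"
  assumes "P w" "\<And>w'. P w' \<Longrightarrow> g w \<le> g w'"
  shows "(LEAST v. \<exists>w. P w \<and> v = g w) = g w"
  using assms by (intro Least_equality) auto

text \<open>Each sublevel set of \<open>h\<close> is the projection of a compact sublevel set of
  \<open>g\<close>: \<open>lower\<close> gives one inclusion, and \<open>attained\<close> the
  other.\<close>

lemma lsc_on_partial_min: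
  fixes D :: "('z::t2_space \<times> 'w::t2_space) set"
  assumes "compact D" "lsc_on D g" "fst ` D \<subseteq> Z"
    and attained: "\<And>z. z \<in> Z \<Longrightarrow> \<exists>w. (z, w) \<in> D \<and> h z = g (z, w)"
    and lower: "\<And>z w. (z, w) \<in> D \<Longrightarrow> h z \<le> g (z, w)"
  shows "lsc_on Z h"
  unfolding lsc_on_iff_closedin
proof
  fix c
  have "compact {d\<in>D. g d \<le> c}"
    using assms(1,2) by (rule lsc_on_compact_sublevel)
  then have "compact (fst ` {d\<in>D. g d \<le> c})"
    by (intro compact_continuous_image continuous_intros)
  moreover have "fst ` {d\<in>D. g d \<le> c} = {z\<in>Z. h z \<le> c}"
  proof (intro equalityI subsetI)
    fix z assume "z \<in> fst ` {d\<in>D. g d \<le> c}"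
    then show "z \<in> {z\<in>Z. h z \<le> c}"
      using assms(3) order_trans[OF lower] by auto
  next
    fix z assume "z \<in> {z\<in>Z. h z \<le> c}"
    with attained[of z] show "z \<in> fst ` {d\<in>D. g d \<le> c}"
      by (force simp: image_iff)
  qed
  ultimately show "closedin (top_of_set Z) {z\<in>Z. h z \<le> c}"
    by (intro closed_subset) (auto intro: compact_imp_closed)
qed

section \<open>Lipschitz functions with respect to an arbitrary norm\<close>

text \<open>Homogeneity and the triangle inequality make a norm convex, and a finite convex function
  on a Euclidean space is continuous.\<close>

lemma is_norm_continuous_on:
  fixes N :: "'a::euclidean_space \<Rightarrow> real"
  assumes "is_norm N"
  shows "continuous_on S N"
proof -
  have "convex_on UNIV N"
    unfolding convex_on_def
  proof (intro conjI ballI allI impI convex_UNIV)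
    fix x y :: 'a and u v :: real assume "0 \<le> u" "0 \<le> v"
    moreover have "N (u *\<^sub>R x + v *\<^sub>R y) \<le> N (u *\<^sub>R x) + N (v *\<^sub>R y)"
      "N (u *\<^sub>R x) = \<bar>u\<bar> * N x" "N (v *\<^sub>R y) = \<bar>v\<bar> * N y"
      using assms unfolding is_norm_def by blast+
    ultimately show "N (u *\<^sub>R x + v *\<^sub>R y) \<le> u * N x + v * N y"
      by simp
  qed
  then show ?thesis
    using convex_on_continuous continuous_on_subset by blast
qed

lemma lipschitz_wrt_continuous_on:
  fixes N :: "'a::euclidean_space \<Rightarrow> real"
  assumes N: "is_norm N" and g: "lipschitz_wrt N L S g"
  shows "continuous_on S g"
  unfolding continuous_on_def
proof
  fix u assume u: "u \<in> S"
  have "continuous_on S (\<lambda>x. L * N (x - u))"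
    by (intro continuous_intros continuous_on_compose2[OF is_norm_continuous_on[OF N]]) auto
  then have "((\<lambda>x. L * N (x - u)) \<longlongrightarrow> L * N (u - u)) (at u within S)"
    using u by (auto simp: continuous_on_def)
  moreover have "N (u - u) = 0"
    using N by (simp add: is_norm_def)
  ultimately have lim: "((\<lambda>x. L * N (x - u)) \<longlongrightarrow> 0) (at u within S)"
    by simp
  have "\<forall>\<^sub>F x in at u within S. norm (g x - g u) \<le> L * N (x - u)"
    using g u by (auto simp: lipschitz_wrt_def eventually_at_filter)
  then have "((\<lambda>x. g x - g u) \<longlongrightarrow> 0) (at u within S)"
    using lim by (rule Lim_null_comparison)
  then show "(g \<longlongrightarrow> g u) (at u within S)"
    by (simp add: LIM_zero_iff)
qed

text \<open>In the induction over the tree, this turns the Lipschitz property of the children into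
  the lower semicontinuity needed for the next minimum to exist. Finiteness lets
  \<open>ennreal\<close> undo \<open>enn2real\<close>.\<close>

lemma ext_lipschitz_wrt_lsc_on:
  fixes N :: "'a::euclidean_space \<Rightarrow> real"
  assumes "is_norm N" "ext_lipschitz_wrt N L S g"
  shows "lsc_on S g"
proof (rule continuous_imp_lsc_on)
  have "continuous_on S (\<lambda>x. enn2real (g x))"
    using assms lipschitz_wrt_continuous_on unfolding ext_lipschitz_wrt_def by blast
  then have "continuous_on S (\<lambda>x. ennreal (enn2real (g x)))"
    by (rule continuous_on_ennreal)
  then show "continuous_on S g"
    by (rule continuous_on_eq) (use assms(2) in \<open>auto simp: ext_lipschitz_wrt_def\<close>)
qed

text \<open>The one-sided estimate avoids subtraction in extended values; exchanging
  \<open>u\<close> and \<open>v\<close> recovers the absolute value.\<close>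

lemma ext_lipschitz_wrtI:
  assumes N: "is_norm N" and L: "0 \<le> L"
    and fin: "\<And>u. u \<in> S \<Longrightarrow> g u < \<infinity>"
    and le: "\<And>u v. u \<in> S \<Longrightarrow> v \<in> S \<Longrightarrow> g u \<le> g v + ennreal (L * N (u - v))"
  shows "ext_lipschitz_wrt N L S g"
proof -
  have pos: "0 \<le> L * N x" for x
    using N L by (simp add: is_norm_def)
  have sym: "N (u - v) = N (v - u)" for u v
  proof -
    \<comment> \<open>Symmetry of the distance is homogeneity with factor -1.\<close>
    have "N ((- 1) *\<^sub>R (u - v)) = \<bar>- 1\<bar> * N (u - v)"
      using N unfolding is_norm_def by blast
    then show ?thesis by simp
  qed
  have real_le: "enn2real (g u) \<le> enn2real (g v) + L * N (u - v)" if "u \<in> S" "v \<in> S" for u v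
  proof -
    have "ennreal (enn2real (g u)) \<le> ennreal (enn2real (g v)) + ennreal (L * N (u - v))"
      using le[OF that] fin that by simp
    also have "\<dots> = ennreal (enn2real (g v) + L * N (u - v))"
      using pos by simp
    finally show ?thesis
      using pos by (subst (asm) ennreal_le_iff) simp_all
  qed
  have "\<bar>enn2real (g u) - enn2real (g v)\<bar> \<le> L * N (u - v)" if "u \<in> S" "v \<in> S" for u v
    using real_le[OF that] real_le[OF that(2,1)] sym[of u v] by (simp add: abs_le_iff)
  then show ?thesis
    using L fin by (simp add: ext_lipschitz_wrt_def lipschitz_wrt_def)
qed

section \<open>Attainment for the original problem\<close>

context multistage_program
begin

abbreviation "parent_states n \<equiv> state_set F r par (par n)"
abbreviation "Q \<equiv> value_fun Nodes par p F f"

abbreviation expected_cost :: "('n \<Rightarrow> 'a \<Rightarrow> ennreal) \<Rightarrow> 'n \<Rightarrow> 'a \<Rightarrow> ennreal" where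
  "expected_cost V n x \<equiv> \<Sum>m\<in>children Nodes par n. ennreal (p m / p n) * V m x"

lemma node_induct [consumes 1, case_names node]:
  assumes "n \<in> Nodes"
    and "\<And>n. n \<in> Nodes \<Longrightarrow> (\<And>m. m \<in> children Nodes par n \<Longrightarrow> P m) \<Longrightarrow> P n"
  shows "P n"
  using wf_child_rel assms(1)
proof (induction n rule: wf_induct_rule)
  case (less n)
  show ?case
  proof (rule assms(2)[OF less.prems])
    fix m assume "m \<in> children Nodes par n"
    then show "P m"
      using less.prems by (intro less.IH) (simp_all add: child_rel_def children_def)
  qed
qed

section \<open>State sets and cost domains: compactness, convexity, feasibility\<close>

lemma parent_states_child:
  assumes "n \<in> Nodes" "m \<in> children Nodes par n"
  shows "parent_states m = fst ` F n"
  using assms par_root by (auto simp: children_def state_set_def)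

lemma compact_parent_states:
  assumes "n \<in> Nodes"
  shows "compact (parent_states n)"
proof (cases "n = r")
  case False
  then have "compact (F (par n))"
    using assms par_in compact_F by blast
  then show ?thesis
    by (auto simp: state_set_def intro!: compact_continuous_image continuous_intros)
qed (simp add: state_set_def)

lemma parent_states_in_E:
  assumes "n \<in> Nodes"
  shows "parent_states n \<subseteq> E (par n)"
proof (cases "n = r")
  case True
  then show ?thesis
    using subspace_E[of "par r"] by (auto simp: state_set_def subspace_0)
next
  case False
  then have "fst ` F (par n) \<subseteq> E (par n)" "par n \<noteq> par r"
    using assms par_in states_in_E par_root by metis+
  then show ?thesis
    by (simp add: state_set_def)
qed

text \<open>The penalty axioms hold only on the subspace \<open>E (par n)\<close>, so the arguments
  passed to the penalty must be placed there.\<close>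

lemma diff_in_E:
  assumes "n \<in> Nodes" "u \<in> parent_states n" "v \<in> parent_states n"
  shows "u - v \<in> E (par n)"
proof -
  have "par n \<in> insert (par r) Nodes"
    using assms(1) par_in by blast
  then show ?thesis
    using assms parent_states_in_E subspace_E by (intro subspace_diff) auto
qed

lemma convex_parent_states:
  assumes "n \<in> Nodes" "\<forall>n\<in>Nodes. convex (F n)"
  shows "convex (parent_states n)"
  using assms par_in
  by (cases "n = r") (auto simp: state_set_def intro!: convex_linear_image linear_fst)

lemma mem_cost_domain_iff:
  "(z, y, x) \<in> cost_domain F r par n \<longleftrightarrow> z \<in> parent_states n \<and> (x, y) \<in> F n"
  by (simp add: cost_domain_def)

lemma compact_cost_domain:
  assumes "n \<in> Nodes"
  shows "compact (cost_domain F r par n)"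
proof -
  have "cost_domain F r par n = (\<lambda>(z, x, y). (z, y, x)) ` (parent_states n \<times> F n)"
    by (force simp: cost_domain_def image_iff)
  moreover have "compact (parent_states n \<times> F n)"
    using assms by (intro compact_Times compact_parent_states compact_F)
  ultimately show ?thesis
    by (auto simp: case_prod_beta intro!: compact_continuous_image continuous_intros)
qed

text \<open>A finite sum of nonnegative extended terms has only finite terms, and the positive
  weight can be cancelled. The point obtained later bounds the regularised value function at every
  argument.\<close>

lemma feasible_point:
  assumes "n \<in> Nodes"
  obtains z y x where "(z, y, x) \<in> cost_domain F r par n" "f n z y x < \<infinity>"
proof -
  obtain x y where xy: "x (par r) = 0" "\<forall>n\<in>Nodes. (x n, y n) \<in> F n"
    and fin: "(\<Sum>n\<in>Nodes. ennreal (p n) * f n (x (par n)) (y n) (x n)) < \<infinity>"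
    using feasible by blast
  have "ennreal (p n) * f n (x (par n)) (y n) (x n) < \<infinity>"
    using fin assms finite_Nodes by (simp add: less_top)
  then have "f n (x (par n)) (y n) (x n) < \<infinity>"
    using p_pos[OF assms] by (auto simp: ennreal_mult_less_top)
  moreover have "x (par n) \<in> parent_states n"
    using xy assms par_in par_root by (cases "n = r") (force simp: state_set_def)+
  ultimately show thesis
    using that xy(2) assms by (auto simp: mem_cost_domain_iff)
qed

text \<open>\<open>V m\<close> is controlled only on the state set of the parent of
  \<open>m\<close>, which is the projection of \<open>F n\<close>; the \<open>x\<close>-component of
  a point of the cost domain lies exactly there.\<close>

lemma lsc_on_expected_cost:
  assumes n: "n \<in> Nodes"
    and V: "\<And>m. m \<in> children Nodes par n \<Longrightarrow> lsc_on (parent_states m) (V m)"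
  shows "lsc_on (cost_domain F r par n) (\<lambda>(z, y, x). expected_cost V n x)"
  unfolding case_prod_beta
proof (rule lsc_on_sum)
  fix m assume m: "m \<in> children Nodes par n"
  then have "0 < p m / p n"
    using n p_pos by (simp add: children_def)
  moreover have "lsc_on (cost_domain F r par n) (\<lambda>d. V m (snd (snd d)))"
    by (rule lsc_on_compose[OF V[OF m]])
      (force simp: parent_states_child[OF n m] mem_cost_domain_iff intro!: continuous_intros)+
  ultimately show "lsc_on (cost_domain F r par n)
      (\<lambda>d. ennreal (p m / p n) * V m (snd (snd d)))"
    by (intro lsc_on_cmult)
qed

text \<open>The two claims need each other: attainment at \<open>n\<close> uses semicontinuity at
  the children, and semicontinuity at \<open>n\<close> uses attainment at \<open>n\<close>. Values
  may be infinite here.\<close>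

lemma value_fun_lsc_attained:
  assumes "n \<in> Nodes"
  shows "lsc_on (parent_states n) (Q n) \<and>
    (\<forall>xa\<in>parent_states n. \<exists>(x, y)\<in>F n. Q n xa = f n xa y x + expected_cost Q n x)"
  using assms
proof (induction rule: node_induct)
  case (node n)
  let ?D = "cost_domain F r par n"
  let ?g = "\<lambda>(z, y, x). f n z y x + expected_cost Q n x"
  have lsc: "lsc_on ?D ?g"
    using lsc_on_add[OF lsc_f[OF node.hyps] lsc_on_expected_cost[OF node.hyps, of Q]] node.IH
    by (simp add: case_prod_unfold)
  have min: "\<exists>w. (xa, w) \<in> ?D \<and> Q n xa = ?g (xa, w) \<and> (\<forall>w'. (xa, w') \<in> ?D \<longrightarrow> Q n xa \<le> ?g (xa, w'))"
    if xa: "xa \<in> parent_states n" for xa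
  proof -
    \<comment> \<open>With \<open>xa\<close> fixed, the objective is restricted to a slice of
      \<open>?D\<close>, parametrised by the compact set \<open>F n\<close>.\<close>
    let ?h = "\<lambda>(x, y). f n xa y x + expected_cost Q n x"
    have "lsc_on (F n) ?h"
    proof -
      have cont: "continuous_on (F n) (\<lambda>w. (xa, snd w, fst w))"
        by (intro continuous_intros)
      have "(\<lambda>w. (xa, snd w, fst w)) ` F n \<subseteq> ?D"
        using xa by (auto simp: mem_cost_domain_iff)
      from lsc_on_compose[OF lsc cont this] show ?thesis
        by (simp add: case_prod_unfold)
    qed
    moreover have "F n \<noteq> {}"
      using feasible node.hyps by blast
    ultimately obtain w where w: "w \<in> F n" "\<And>w'. w' \<in> F n \<Longrightarrow> ?h w \<le> ?h w'"
      using lsc_on_attains_min[OF compact_F[OF node.hyps]] by blast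
    have "Q n xa = (LEAST v. \<exists>w. w \<in> F n \<and> v = ?h w)"
      by (simp add: value_fun_eq[OF node.hyps])
    also have "\<dots> = ?h w"
      using w by (rule Least_attained)
    finally have "Q n xa = ?h w" .
    with w xa show ?thesis
      by (intro exI[of _ "(snd w, fst w)"]) (fastforce simp: mem_cost_domain_iff case_prod_beta)
  qed
  have "lsc_on (parent_states n) (Q n)"
  proof (rule lsc_on_partial_min[OF compact_cost_domain[OF node.hyps] lsc])
    show sub: "fst ` ?D \<subseteq> parent_states n"
      by (auto simp: mem_cost_domain_iff)
    show "\<exists>w. (xa, w) \<in> ?D \<and> Q n xa = ?g (xa, w)" if "xa \<in> parent_states n" for xa
      using min[OF that] by blast
    show "Q n xa \<le> ?g (xa, w)" if "(xa, w) \<in> ?D" for xa w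
    proof -
      have "xa \<in> parent_states n"
        using sub that by (force simp: image_subset_iff)
      from min[OF this] that show ?thesis by blast
    qed
  qed
  moreover have "\<exists>(x, y)\<in>F n. Q n xa = f n xa y x + expected_cost Q n x"
    if xa: "xa \<in> parent_states n" for xa
  proof -
    obtain w where w: "(xa, w) \<in> ?D" "Q n xa = ?g (xa, w)"
      using min[OF xa] by blast
    obtain y x where "w = (y, x)"
      by (cases w)
    with w show ?thesis
      by (intro bexI[of _ "(x, y)"]) (simp_all add: mem_cost_domain_iff)
  qed
  ultimately show ?case by blast
qed

end

section \<open>The regularised problem\<close>

locale regularized_program = multistage_program Nodes r par p E F f
  for Nodes :: "'n set" and r :: 'n and par :: "'n \<Rightarrow> 'n" and p :: "'n \<Rightarrow> real"
    and E :: "'n \<Rightarrow> 'a::euclidean_space set"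
    and F :: "'n \<Rightarrow> ('a \<times> 'b::euclidean_space) set"
    and f :: "'n \<Rightarrow> 'a \<Rightarrow> 'b \<Rightarrow> 'a \<Rightarrow> ennreal" +
  fixes nrm :: "'a \<Rightarrow> real" and \<sigma> :: "'n \<Rightarrow> real" and \<psi> :: "'n \<Rightarrow> 'a \<Rightarrow> real"
  assumes norm: "is_norm nrm"
    and sigma_pos: "\<And>n. n \<in> Nodes \<Longrightarrow> \<sigma> n > 0"
    and penalty: "\<And>n. n \<in> Nodes \<Longrightarrow> penalty_function nrm (E (par n)) (\<psi> n)"
    and penalty_lipschitz: "\<And>n. n \<in> Nodes \<Longrightarrow> lipschitz_wrt nrm 1
          {u - v | u v. u \<in> state_set F r par (par n) \<and> v \<in> state_set F r par (par n)} (\<psi> n)"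
begin

abbreviation "QR \<equiv> reg_value_fun Nodes r par p F f \<sigma> \<psi>"

text \<open>Treating the copy \<open>z\<close> as part of the decision turns the regularised minimum
  into one over \<open>cost_domain\<close>, a compact set that does not depend on
  \<open>xa\<close>.\<close>

abbreviation reg_objective :: "'n \<Rightarrow> 'a \<Rightarrow> 'a \<times> 'b \<times> 'a \<Rightarrow> ennreal" where
  "reg_objective n xa \<equiv> \<lambda>(z, y, x).
     f n z y x + ennreal (\<sigma> n * \<psi> n (xa - z)) + expected_cost QR n x"

section \<open>Properties of the penalty term\<close>

lemma penalty_nonneg:
  assumes "n \<in> Nodes" "u \<in> parent_states n" "v \<in> parent_states n"
  shows "0 \<le> \<psi> n (u - v)"
  using penalty[OF assms(1)] diff_in_E[OF assms] by (simp add: penalty_function_def)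

lemma penalty_zero:
  assumes "n \<in> Nodes"
  shows "\<psi> n 0 = 0"
proof -
  have "par n \<in> insert (par r) Nodes"
    using assms par_in by blast
  then show ?thesis
    using penalty[OF assms] subspace_0[OF subspace_E] by (auto simp: penalty_function_def)
qed

text \<open>The shift by \<open>z\<close> cancels in the difference of the two arguments, so the
  bound is uniform in \<open>z\<close>.\<close>

lemma penalty_diff_le:
  assumes "n \<in> Nodes" "u \<in> parent_states n" "v \<in> parent_states n" "z \<in> parent_states n"
  shows "\<psi> n (u - z) \<le> \<psi> n (v - z) + nrm (u - v)"
proof -
  have "\<bar>\<psi> n (u - z) - \<psi> n (v - z)\<bar> \<le> 1 * nrm ((u - z) - (v - z))"
    using penalty_lipschitz[OF assms(1)] assms(2-4) unfolding lipschitz_wrt_def by blast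
  then show ?thesis by simp
qed

lemma lsc_on_penalty:
  assumes n: "n \<in> Nodes" and xa: "xa \<in> parent_states n"
  shows "lsc_on (cost_domain F r par n) (\<lambda>(z, y, x). ennreal (\<sigma> n * \<psi> n (xa - z)))"
  unfolding case_prod_beta
proof (intro continuous_imp_lsc_on continuous_on_ennreal continuous_on_mult continuous_on_const)
  show "continuous_on (cost_domain F r par n) (\<lambda>d. \<psi> n (xa - fst d))"
  proof (rule continuous_on_compose2[OF lipschitz_wrt_continuous_on[OF norm penalty_lipschitz[OF n]]])
    show "continuous_on (cost_domain F r par n) (\<lambda>d. xa - fst d)"
      by (intro continuous_intros)
    show "(\<lambda>d. xa - fst d) ` cost_domain F r par n
        \<subseteq> {u - v | u v. u \<in> parent_states n \<and> v \<in> parent_states n}"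
      using xa by (auto simp: mem_cost_domain_iff) blast
  qed
qed

text \<open>Semicontinuity at the children is a hypothesis because the result is used inside the
  induction that establishes it.\<close>

lemma QR_min:
  assumes n: "n \<in> Nodes" and xa: "xa \<in> parent_states n"
    and lsc: "\<forall>m\<in>children Nodes par n. lsc_on (parent_states m) (QR m)"
  obtains z y x where "(z, y, x) \<in> cost_domain F r par n"
    "QR n xa = reg_objective n xa (z, y, x)"
    "\<And>d. d \<in> cost_domain F r par n \<Longrightarrow> QR n xa \<le> reg_objective n xa d"
proof -
  let ?D = "cost_domain F r par n"
  have "lsc_on ?D (reg_objective n xa)"
    using lsc_on_add[OF lsc_on_add[OF lsc_f[OF n] lsc_on_penalty[OF n xa]]
        lsc_on_expected_cost[OF n bspec[OF lsc]]]
    by (simp add: case_prod_unfold)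
  moreover have "?D \<noteq> {}"
    using feasible_point[OF n] by blast
  ultimately obtain d where d: "d \<in> ?D"
    "\<And>d'. d' \<in> ?D \<Longrightarrow> reg_objective n xa d \<le> reg_objective n xa d'"
    using lsc_on_attains_min[OF compact_cost_domain[OF n]] by blast
  obtain z y x where zyx: "d = (z, y, x)"
    by (cases d)
  have "QR n xa = (LEAST v. \<exists>d. d \<in> ?D \<and> v = reg_objective n xa d)"
    unfolding reg_value_fun_eq[OF n]
    by (rule arg_cong[where f = Least]) (fastforce simp: mem_cost_domain_iff)
  also have "\<dots> = reg_objective n xa d"
    using d by (rule Least_attained)
  finally have "QR n xa = reg_objective n xa d" .
  with d show thesis
    unfolding zyx by (intro that[of z y x]) simp_all
qed

lemma QR_lower:
  assumes "n \<in> Nodes" "xa \<in> parent_states n"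
    and "\<forall>m\<in>children Nodes par n. lsc_on (parent_states m) (QR m)"
    and d: "d \<in> cost_domain F r par n"
  shows "QR n xa \<le> reg_objective n xa d"
proof (rule QR_min[OF assms(1-3)])
  assume "\<And>d. d \<in> cost_domain F r par n \<Longrightarrow> QR n xa \<le> reg_objective n xa d"
  from this[OF d] show ?thesis .
qed

text \<open>The feasible set is the same for all arguments, so a minimiser for \<open>v\<close>
  competes for \<open>u\<close>, at an extra cost of at most
  \<open>\<sigma> n * nrm (u - v)\<close>. The children contribute only existence of minima and
  finiteness, hence their Lipschitz constants do not accumulate.\<close>

lemma QR_ext_lipschitz:
  assumes "n \<in> Nodes"
  shows "ext_lipschitz_wrt nrm (\<sigma> n) (parent_states n) (QR n)"
  using assms
proof (induction rule: node_induct)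
  case (node n)
  note n = node.hyps
  have lsc: "\<forall>m\<in>children Nodes par n. lsc_on (parent_states m) (QR m)"
    using ext_lipschitz_wrt_lsc_on[OF norm node.IH] by blast
  show ?case
  proof (rule ext_lipschitz_wrtI[OF norm])
    show "0 \<le> \<sigma> n"
      using sigma_pos[OF n] by simp
  next
    fix u assume u: "u \<in> parent_states n"
    \<comment> \<open>One point of finite cost serves every \<open>u\<close>: its copy
      \<open>z\<close> need not equal \<open>u\<close>, and the discrepancy costs only a finite
      penalty.\<close>
    obtain z y x where zyx: "(z, y, x) \<in> cost_domain F r par n" "f n z y x < \<infinity>"
      using feasible_point[OF n] .
    have "QR m x < \<infinity>" if "m \<in> children Nodes par n" for m
      using node.IH[OF that] zyx(1) parent_states_child[OF n that]
      by (force simp: ext_lipschitz_wrt_def mem_cost_domain_iff)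
    then have "reg_objective n u (z, y, x) < \<infinity>"
      using zyx(2) finite_Nodes by (auto simp: ennreal_mult_less_top children_def)
    moreover have "QR n u \<le> reg_objective n u (z, y, x)"
      by (rule QR_lower[OF n u lsc zyx(1)])
    ultimately show "QR n u < \<infinity>"
      by (rule le_less_trans[rotated])
  next
    fix u v assume u: "u \<in> parent_states n" and v: "v \<in> parent_states n"
    obtain z y x where zyx: "(z, y, x) \<in> cost_domain F r par n"
      and min: "QR n v = reg_objective n v (z, y, x)"
      by (rule QR_min[OF n v lsc])
    have z: "z \<in> parent_states n"
      using zyx by (simp add: mem_cost_domain_iff)
    have "\<sigma> n * \<psi> n (u - z) \<le> \<sigma> n * \<psi> n (v - z) + \<sigma> n * nrm (u - v)"
      using mult_left_mono[OF penalty_diff_le[OF n u v z], of "\<sigma> n"] sigma_pos[OF n]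
      by (simp add: distrib_left)
    \<comment> \<open>\<open>ennreal\<close> is additive on nonnegative reals, hence the sign
      conditions.\<close>
    moreover have "0 \<le> \<sigma> n * \<psi> n (v - z)" "0 \<le> \<sigma> n * nrm (u - v)"
      using sigma_pos[OF n] penalty_nonneg[OF n v z] norm by (simp_all add: is_norm_def)
    ultimately have pen: "ennreal (\<sigma> n * \<psi> n (u - z))
        \<le> ennreal (\<sigma> n * \<psi> n (v - z)) + ennreal (\<sigma> n * nrm (u - v))"
      by (metis ennreal_leI ennreal_plus)
    have "QR n u \<le> reg_objective n u (z, y, x)"
      by (rule QR_lower[OF n u lsc zyx])
    also have "\<dots> \<le> f n z y x + (ennreal (\<sigma> n * \<psi> n (v - z)) + ennreal (\<sigma> n * nrm (u - v)))
        + expected_cost QR n x"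
      using pen by (auto intro!: add_mono)
    also have "\<dots> = QR n v + ennreal (\<sigma> n * nrm (u - v))"
      by (simp add: min ac_simps)
    finally show "QR n u \<le> QR n v + ennreal (\<sigma> n * nrm (u - v))" .
  qed
qed

lemma QR_lsc: "\<forall>m\<in>children Nodes par n. lsc_on (parent_states m) (QR m)"
proof
  fix m assume "m \<in> children Nodes par n"
  then have "m \<in> Nodes"
    by (simp add: children_def)
  then show "lsc_on (parent_states m) (QR m)"
    by (rule ext_lipschitz_wrt_lsc_on[OF norm QR_ext_lipschitz])
qed

lemma QR_le_objective:
  assumes "n \<in> Nodes" "xa \<in> parent_states n" "d \<in> cost_domain F r par n"
  shows "QR n xa \<le> reg_objective n xa d"
  by (rule QR_lower[OF assms(1,2) QR_lsc assms(3)])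

lemma QR_le_Q:
  assumes "n \<in> Nodes"
  shows "\<forall>xa\<in>parent_states n. QR n xa \<le> Q n xa"
  using assms
proof (induction rule: node_induct)
  case (node n)
  note n = node.hyps
  show ?case
  proof
    fix xa assume xa: "xa \<in> parent_states n"
    then obtain x y where xy: "(x, y) \<in> F n" and Q: "Q n xa = f n xa y x + expected_cost Q n x"
      using value_fun_lsc_attained[OF n] by blast
    \<comment> \<open>An original minimiser \<open>(x, y)\<close> is combined with the copy
      \<open>z = xa\<close>, which is admissible and has zero penalty.\<close>
    have "QR n xa \<le> reg_objective n xa (xa, y, x)"
      using xa xy by (intro QR_le_objective[OF n]) (simp_all add: mem_cost_domain_iff)
    also have "\<dots> = f n xa y x + expected_cost QR n x"
      by (simp add: penalty_zero[OF n])
    also have "\<dots> \<le> f n xa y x + expected_cost Q n x"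
    proof (intro add_left_mono sum_mono mult_left_mono)
      fix m assume m: "m \<in> children Nodes par n"
      have "x \<in> parent_states m"
        using xy by (force simp: parent_states_child[OF n m])
      then show "QR m x \<le> Q m x"
        using node.IH[OF m] by blast
    qed simp
    finally show "QR n xa \<le> Q n xa"
      by (simp add: Q)
  qed
qed

text \<open>The convex combination of minimisers for \<open>a\<close> and \<open>b\<close> competes
  at the combined argument; each of the three terms of the objective is then estimated separately,
  the expected cost by induction.\<close>

lemma QR_convex:
  assumes n: "n \<in> Nodes"
    and cF: "\<forall>n\<in>Nodes. convex (F n)"
    and cf: "\<forall>n\<in>Nodes. ext_convex_on (cost_domain F r par n) (\<lambda>(z, y, x). f n z y x)"
    and c\<psi>: "\<forall>n\<in>Nodes. convex_on (E (par n)) (\<psi> n)"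
  shows "ext_convex_on (parent_states n) (QR n)"
  using n
proof (induction rule: node_induct)
  case (node n)
  note n = node.hyps
  let ?D = "cost_domain F r par n"
  show ?case
    unfolding ext_convex_on_def
  proof (intro conjI ballI allI impI convex_parent_states[OF n cF])
    fix a b :: 'a and u v :: real
    assume ab: "a \<in> parent_states n" "b \<in> parent_states n" and uv: "0 \<le> u" "0 \<le> v" "u + v = 1"
    obtain z1 y1 x1 where 1: "(z1, y1, x1) \<in> ?D" "QR n a = reg_objective n a (z1, y1, x1)"
      by (rule QR_min[OF n ab(1) QR_lsc])
    obtain z2 y2 x2 where 2: "(z2, y2, x2) \<in> ?D" "QR n b = reg_objective n b (z2, y2, x2)"
      by (rule QR_min[OF n ab(2) QR_lsc])
    define c z y x where "c = u *\<^sub>R a + v *\<^sub>R b" and "z = u *\<^sub>R z1 + v *\<^sub>R z2"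
      and "y = u *\<^sub>R y1 + v *\<^sub>R y2" and "x = u *\<^sub>R x1 + v *\<^sub>R x2"
    have c: "c \<in> parent_states n"
      unfolding c_def using convexD[OF convex_parent_states[OF n cF]] ab uv by blast
    have zyx: "(z, y, x) = u *\<^sub>R (z1, y1, x1) + v *\<^sub>R (z2, y2, x2)"
      by (simp add: z_def y_def x_def)
    \<comment> \<open>Convexity of the cost domain is part of \<open>ext_convex_on\<close> for the
      cost.\<close>
    have D: "(z, y, x) \<in> ?D"
      unfolding zyx using cf n 1(1) 2(1) uv by (intro convexD) (auto simp: ext_convex_on_def)
    have f_le: "f n z y x \<le> ennreal u * f n z1 y1 x1 + ennreal v * f n z2 y2 x2"
    proof -
      have "(\<lambda>(z, y, x). f n z y x) (u *\<^sub>R (z1, y1, x1) + v *\<^sub>R (z2, y2, x2))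
          \<le> ennreal u * (\<lambda>(z, y, x). f n z y x) (z1, y1, x1)
            + ennreal v * (\<lambda>(z, y, x). f n z y x) (z2, y2, x2)"
        using cf n 1(1) 2(1) uv unfolding ext_convex_on_def by blast
      then show ?thesis
        by (simp only: zyx[symmetric] prod.case)
    qed
    have z12: "z1 \<in> parent_states n" "z2 \<in> parent_states n"
      using 1(1) 2(1) by (simp_all add: mem_cost_domain_iff)
    have \<psi>_le: "ennreal (\<sigma> n * \<psi> n (c - z))
        \<le> ennreal u * ennreal (\<sigma> n * \<psi> n (a - z1)) + ennreal v * ennreal (\<sigma> n * \<psi> n (b - z2))"
    proof -
      \<comment> \<open>The penalty is jointly convex in argument and copy, because
        \<open>c - z\<close> is the same convex combination of \<open>a - z1\<close> and
        \<open>b - z2\<close>.\<close>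
      have "\<psi> n (u *\<^sub>R (a - z1) + v *\<^sub>R (b - z2)) \<le> u * \<psi> n (a - z1) + v * \<psi> n (b - z2)"
        using c\<psi> n uv diff_in_E[OF n] ab z12 unfolding convex_on_def by blast
      moreover have "u *\<^sub>R (a - z1) + v *\<^sub>R (b - z2) = c - z"
        by (simp add: c_def z_def algebra_simps)
      ultimately have "\<sigma> n * \<psi> n (c - z) \<le> \<sigma> n * (u * \<psi> n (a - z1) + v * \<psi> n (b - z2))"
        using sigma_pos[OF n] by simp
      also have "\<dots> = u * (\<sigma> n * \<psi> n (a - z1)) + v * (\<sigma> n * \<psi> n (b - z2))"
        by (simp add: algebra_simps)
      finally have "ennreal (\<sigma> n * \<psi> n (c - z))
          \<le> ennreal (u * (\<sigma> n * \<psi> n (a - z1)) + v * (\<sigma> n * \<psi> n (b - z2)))"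
        by (rule ennreal_leI)
      also have "\<dots> = ennreal u * ennreal (\<sigma> n * \<psi> n (a - z1))
          + ennreal v * ennreal (\<sigma> n * \<psi> n (b - z2))"
      proof -
        have pos: "0 \<le> \<sigma> n * \<psi> n (a - z1)" "0 \<le> \<sigma> n * \<psi> n (b - z2)"
          using sigma_pos[OF n] penalty_nonneg[OF n ab(1) z12(1)] penalty_nonneg[OF n ab(2) z12(2)]
          by simp_all
        then show ?thesis
          using uv(1,2) by (simp only: ennreal_plus ennreal_mult mult_nonneg_nonneg)
      qed
      finally show ?thesis .
    qed
    have E_le: "expected_cost QR n x
        \<le> ennreal u * expected_cost QR n x1 + ennreal v * expected_cost QR n x2"
    proof -
      have "expected_cost QR n x \<le> (\<Sum>m\<in>children Nodes par n.
          ennreal (p m / p n) * (ennreal u * QR m x1 + ennreal v * QR m x2))"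
      proof (intro sum_mono mult_left_mono)
        fix m assume m: "m \<in> children Nodes par n"
        have "x1 \<in> parent_states m" "x2 \<in> parent_states m"
          using 1(1) 2(1) by (force simp: parent_states_child[OF n m] mem_cost_domain_iff)+
        then show "QR m x \<le> ennreal u * QR m x1 + ennreal v * QR m x2"
          unfolding x_def using node.IH[OF m] uv unfolding ext_convex_on_def by blast
      qed simp
      also have "\<dots> = ennreal u * expected_cost QR n x1 + ennreal v * expected_cost QR n x2"
        by (simp add: sum_distrib_left distrib_left sum.distrib mult.left_commute)
      finally show ?thesis .
    qed
    have "QR n c \<le> reg_objective n c (z, y, x)"
      using QR_le_objective[OF n c D] .
    also have "\<dots> \<le> (ennreal u * f n z1 y1 x1 + ennreal v * f n z2 y2 x2)
        + (ennreal u * ennreal (\<sigma> n * \<psi> n (a - z1)) + ennreal v * ennreal (\<sigma> n * \<psi> n (b - z2)))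
        + (ennreal u * expected_cost QR n x1 + ennreal v * expected_cost QR n x2)"
      unfolding prod.case by (intro add_mono f_le \<psi>_le E_le)
    also have "\<dots> = ennreal u * QR n a + ennreal v * QR n b"
      unfolding 1(2) 2(2) prod.case distrib_left by (simp only: ac_simps)
    finally show "QR n (u *\<^sub>R a + v *\<^sub>R b) \<le> ennreal u * QR n a + ennreal v * QR n b"
      by (simp add: c_def)
  qed
qed

end

theorem proposition2:
  fixes Nodes :: "'n set" and r :: 'n and par :: "'n \<Rightarrow> 'n" and p :: "'n \<Rightarrow> real"
    and E :: "'n \<Rightarrow> 'a::euclidean_space set"
    and F :: "'n \<Rightarrow> ('a \<times> 'b::euclidean_space) set"
    and f :: "'n \<Rightarrow> 'a \<Rightarrow> 'b \<Rightarrow> 'a \<Rightarrow> ennreal"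
    and nrm :: "'a \<Rightarrow> real" and \<sigma> :: "'n \<Rightarrow> real" and \<psi> :: "'n \<Rightarrow> 'a \<Rightarrow> real"
  assumes program: "multistage_program Nodes r par p E F f"
    and norm: "is_norm nrm"
    and sigma_pos: "\<forall>n\<in>Nodes. \<sigma> n > 0"
    and penalty: "\<forall>n\<in>Nodes. penalty_function nrm (E (par n)) (\<psi> n)"
    and penalty_lipschitz: "\<forall>n\<in>Nodes. lipschitz_wrt nrm 1
          {u - v | u v. u \<in> state_set F r par (par n) \<and> v \<in> state_set F r par (par n)} (\<psi> n)"
  shows "(\<forall>n\<in>Nodes.
            (\<forall>x\<in>state_set F r par (par n).
               reg_value_fun Nodes r par p F f \<sigma> \<psi> n x \<le> value_fun Nodes par p F f n x) \<and>
            ext_lipschitz_wrt nrm (\<sigma> n) (state_set F r par (par n))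
              (reg_value_fun Nodes r par p F f \<sigma> \<psi> n)) \<and>
         ((\<forall>n\<in>Nodes. convex (F n) \<and>
              ext_convex_on (cost_domain F r par n) (\<lambda>(z, y, x). f n z y x) \<and>
              convex_on (E (par n)) (\<psi> n)) \<longrightarrow>
          (\<forall>n\<in>Nodes. ext_convex_on (state_set F r par (par n))
              (reg_value_fun Nodes r par p F f \<sigma> \<psi> n)))"
proof -
  interpret regularized_program Nodes r par p E F f nrm \<sigma> \<psi>
    using assms by (auto simp: regularized_program_def regularized_program_axioms_def)
  show ?thesis
    using QR_le_Q QR_ext_lipschitz QR_convex by blast
qed

end
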